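(* As $n\to\infty$, the probability $P_n(j)$ of a gap of length $j$ in the far-difference decompositions of the integers in $(S_{n-1},S_n]$ converges to a limit $P(j)$, which has geometric decay for $j\ge4$ with decay constant equal to the golden mean. Specifically, with $\phi=\frac{1+\sqrt5}{2}$ and $a_1=\phi/\sqrt5$, one has $P(j)=0$ if $j\le2$ and $$P(j)=\begin{cases}\dfrac{10a_1\phi}{\phi^4-1}\,\phi^{-j} & \text{if } j\ge4,\\[8pt] \dfrac{5a_1}{\phi^2(\phi^4-1)} & \text{if } j=3.\end{cases}$$
   Context: The Fibonacci numbers are indexed by $F_1=1$, $F_2=2$, $F_{n+1}=F_n+F_{n-1}$. A far-difference representation of an integer $m$ is an expression $m=\epsilon_{i_k}F_{i_k}+\epsilon_{i_{k-1}}F_{i_{k-1}}+\cdots+\epsilon_{i_1}F_{i_1}$ with $i_1<i_2<\cdots<i_k$ and each $\epsilon\in\{-1,1\}$, such that any two summands of opposite sign have indices differing by at least $3$ and any two summands of the same sign have indices differing by at least $4$. It is known (Alpert) that every integer has a unique far-difference representation. Set $S_n=F_n+F_{n-4}+F_{n-8}+\cdots$ (the sum over positive indices). The gaps of $m$ are the differences $i_2-i_1,\dots,i_k-i_{k-1}$ between indices of adjacent summands, regardless of sign. $P_n(j)$ is the proportion, among all gaps from the far-difference representations of all integers $m\in(S_{n-1},S_n]$, of those of length exactly $j$; $P(j)=\lim_{n\to\infty}P_n(j)$. The constant $a_1=\phi/\sqrt5$ is the coefficient of $\phi^n$ in Binet's formula for $F_n$ with this indexing. *)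

theory Defs
  imports Complex_Main "HOL-Number_Theory.Fib"
begin

text \<open>Fibonacci numbers indexed by F 1 = 1, F 2 = 2. Only positive indices are ever used.\<close>

definition F :: "nat \<Rightarrow> int" where
  "F n = int (fib (n + 1))"

definition S :: "nat \<Rightarrow> int" where
  "S n = (\<Sum>i | 1 \<le> i \<and> i \<le> n \<and> 4 dvd (n - i). F i)"

text \<open>A representation is the list of pairs (index, sign) of its summands, by increasing index;
  the empty list represents 0. The spacing condition is imposed on all pairs of
  summands, and it forces the indices to be strictly increasing.\<close>

definition far_difference_rep :: "(nat \<times> int) list \<Rightarrow> int \<Rightarrow> bool" where
  "far_difference_rep r m \<longleftrightarrow>
     (\<forall>(i, e) \<in> set r. 1 \<le> i \<and> e \<in> {-1, 1}) \<and>
     sorted_wrt (\<lambda>(i, e) (i', e'). i + (if e = e' then 4 else 3) \<le> i') r \<and>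
     m = (\<Sum>(i, e) \<leftarrow> r. e * F i)"

text \<open>A gap is recorded as a triple: the integer, its representation, and the position k of the
  lower of the two adjacent summands. Every integer has exactly one far-difference representation
  (Alpert), so each integer contributes exactly the gaps of that representation.\<close>

definition gaps :: "nat \<Rightarrow> (int \<times> (nat \<times> int) list \<times> nat) set" where
  "gaps n = {(m, r, k). m \<in> {S (n - 1)<..S n} \<and> far_difference_rep r m \<and> Suc k < length r}"

definition gap_length :: "int \<times> (nat \<times> int) list \<times> nat \<Rightarrow> nat" where
  "gap_length = (\<lambda>(m, r, k). fst (r ! Suc k) - fst (r ! k))"

definition gap_prob :: "nat \<Rightarrow> nat \<Rightarrow> real" where
  "gap_prob n j = real (card {g \<in> gaps n. gap_length g = j}) / real (card (gaps n))"

definition golden_mean :: real where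
  "golden_mean = (1 + sqrt 5) / 2"

text \<open>The coefficient of the n-th power of the golden mean in Binet's formula for F n.\<close>

definition a1 :: real where
  "a1 = golden_mean / sqrt 5"

end

theory Submission
  imports Defs
begin

text \<open>
  Removing the leading summand \<open>F n\<close> from a representation leaves either nothing or a
  representation whose leading index is at most \<open>n - 3\<close> (opposite sign) or at most \<open>n - 4\<close>
  (same sign). Conversely every such remainder may be extended. By induction, the representations
  with leading summand \<open>+F n\<close> are exactly those of the integers in \<open>(S (n - 1), S n]\<close>
  (\<open>rep_value_in_interval_iff\<close>). Hence the gaps can be counted on lists of index-sign pairs.

  Let \<open>a n\<close> be the number of representations with leading summand \<open>+F n\<close>, let \<open>c n\<close> be the total
  number of their summands, and let \<open>w j\<close> be the number of signs that the lower end of a gap of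
  length \<open>j\<close> may have when the sign of the upper end is given: \<open>w 3 = 1\<close>, \<open>w j = 2\<close> for
  \<open>j \<ge> 4\<close>, and \<open>w j = 0\<close> otherwise. Splitting on the leading gap gives the renewal equation
  \<open>c n = a n + (\<Sum>d<n. w d * c (n - d))\<close>, while the number \<open>g n\<close> of gaps of length \<open>j\<close> satisfies
  \<open>g n = w j * a (n - j) + (\<Sum>d<n. w d * g (n - d))\<close>, where
  \<open>a (n - j)\<close> is read as 0 if \<open>j > n\<close>. This is the same equation, shifted by \<open>j\<close> and scaled
  by \<open>w j\<close>, so \<open>g n = w j * c (n - j)\<close> exactly (\<open>num_gaps_eq\<close>). There are
  \<open>c n - a n\<close> gaps in all, one fewer than the number of summands for each representation.
  The probability of a gap of length \<open>j\<close> is therefore \<open>w j * c (n - j) / (c n - a n)\<close>.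

  The two recursions have characteristic polynomial
  \<open>x ^ 4 - x ^ 3 - x - 1 = (x\<^sup>2 - x - 1) * (x\<^sup>2 + 1)\<close>, whose dominant root is \<open>\<phi>\<close>. It is a simple
  root for \<open>a\<close>, so \<open>a n\<close> has order \<open>\<phi> ^ n\<close>, and a double root for \<open>c\<close>, which is driven by
  \<open>a\<close>, so \<open>c n\<close> has order \<open>n * \<phi> ^ n\<close>. Consequently \<open>a n / c n\<close> tends to 0 and
  \<open>c (n - j) / c n\<close> tends to \<open>1 / \<phi> ^ j\<close> (\<open>num_summands_ratio\<close>), and the limiting
  probability is \<open>w j / \<phi> ^ j\<close>. The constants in the
  theorem have this form because \<open>\<phi> ^ 4 - 1 = 5 * a1 * \<phi>\<close>.
\<close>

section \<open>The integers whose leading summand is F n\<close>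

definition spaced :: "(nat \<times> int) list \<Rightarrow> bool" where
  "spaced r \<longleftrightarrow>
     (\<forall>(i, e) \<in> set r. 1 \<le> i \<and> e \<in> {-1, 1}) \<and>
     sorted_wrt (\<lambda>(i, e) (i', e'). i + (if e = e' then 4 else 3) \<le> i') r"

definition rep_value :: "(nat \<times> int) list \<Rightarrow> int" where
  "rep_value r = (\<Sum>(i, e) \<leftarrow> r. e * F i)"

lemma far_difference_rep_iff: "far_difference_rep r m \<longleftrightarrow> spaced r \<and> m = rep_value r"
  by (auto simp: far_difference_rep_def spaced_def rep_value_def)

definition reps_with_top :: "nat \<Rightarrow> int \<Rightarrow> (nat \<times> int) list set" where
  "reps_with_top n s = {r. spaced r \<and> r \<noteq> [] \<and> last r = (n, s)}"

text \<open>Comparing the new summand with the last one suffices: any earlier summand is at distance at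
  least 3 from the last one, hence at distance at least 6 from the new one, so that its sign does
  not matter.\<close>

lemma spaced_snoc:
  assumes "r \<noteq> []" "last r = (i, e)"
  shows "spaced (r @ [(n, s)]) \<longleftrightarrow>
    spaced r \<and> 1 \<le> n \<and> s \<in> {-1, 1} \<and> i + (if e = s then 4 else 3) \<le> n"
proof -
  obtain p where r: "r = p @ [(i, e)]"
    using assms by (metis append_butlast_last_id)
  have "k + (if e' = s then 4 else 3) \<le> n"
    if "k + (if e' = e then 4 else 3) \<le> i" "i + (if e = s then 4 else 3) \<le> n" for k and e' :: int
    using that by (auto split: if_splits)
  then show ?thesis
    unfolding r spaced_def by (fastforce simp: sorted_wrt_append)
qed

lemma spaced_singleton: "spaced [(n, s)] \<longleftrightarrow> 1 \<le> n \<and> s \<in> {-1, 1}"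
  by (simp add: spaced_def)

lemma spaced_last:
  assumes "spaced r" "r \<noteq> []" "last r = (n, s)"
  shows "1 \<le> n" "s = 1 \<or> s = -1"
  using assms last_in_set[of r] by (auto simp: spaced_def)

lemma reps_with_top_0: "reps_with_top 0 s = {}"
  using spaced_last(1) by (fastforce simp: reps_with_top_def)

lemma reps_with_top_decompose:
  assumes "1 \<le> n" "s \<in> {-1, 1}"
  shows "reps_with_top n s = insert [(n, s)] ((\<lambda>r. r @ [(n, s)]) `
    ((\<Union>i\<in>{i. i + 3 \<le> n}. reps_with_top i (- s)) \<union> (\<Union>i\<in>{i. i + 4 \<le> n}. reps_with_top i s)))"
    (is "_ = ?R")
proof (intro equalityI subsetI)
  fix r assume r: "r \<in> reps_with_top n s"
  then obtain p where p: "r = p @ [(n, s)]"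
    unfolding reps_with_top_def by (metis (mono_tags, lifting) append_butlast_last_id mem_Collect_eq)
  show "r \<in> ?R"
  proof (cases "p = []")
    case False
    obtain i e where l: "last p = (i, e)" by fastforce
    have sp: "spaced p" "i + (if e = s then 4 else 3) \<le> n"
      using r spaced_snoc[OF False l, of n s] by (auto simp: p reps_with_top_def)
    then have "e = s \<or> e = - s"
      using spaced_last(2)[OF sp(1) False l] assms(2) by auto
    then show ?thesis
      using sp False l assms(2) by (auto simp: p reps_with_top_def split: if_splits)
  qed (simp add: p)
next
  fix r assume "r \<in> ?R"
  then consider "r = [(n, s)]"
    | p i where "r = p @ [(n, s)]" "p \<in> reps_with_top i (- s)" "i + 3 \<le> n"
    | p i where "r = p @ [(n, s)]" "p \<in> reps_with_top i s" "i + 4 \<le> n"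
    by blast
  then show "r \<in> reps_with_top n s"
  proof cases
    case 1
    then show ?thesis using assms by (simp add: reps_with_top_def spaced_singleton)
  next
    case 2
    then show ?thesis using assms spaced_snoc[of p i "- s" n s] by (auto simp: reps_with_top_def)
  next
    case 3
    then show ?thesis using assms spaced_snoc[of p i s n s] by (auto simp: reps_with_top_def)
  qed
qed

lemma S_0: "S 0 = 0"
  unfolding S_def by (rule sum.neutral) auto

lemma S_step:
  assumes "1 \<le> n"
  shows "S n = F n + S (n - 4)"
proof -
  have "{i. 1 \<le> i \<and> i \<le> n \<and> 4 dvd (n - i)} =
        insert n {i. 1 \<le> i \<and> i \<le> n - 4 \<and> 4 dvd (n - 4 - i)}" (is "?A = insert n ?B")
  proof (intro equalityI subsetI)
    fix i assume i: "i \<in> ?A"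
    show "i \<in> insert n ?B"
    proof (cases "i = n")
      case False
      with i have "4 \<le> n - i" by (auto intro: dvd_imp_le)
      with i have "4 dvd (n - i - 4)" using dvd_diff_nat[of 4 "n - i" 4] by simp
      moreover have "n - i - 4 = n - 4 - i" by simp
      ultimately show ?thesis using i \<open>4 \<le> n - i\<close> by auto
    qed simp
  next
    fix i assume i: "i \<in> insert n ?B"
    show "i \<in> ?A"
    proof (cases "i = n")
      case False
      with i have "4 dvd (n - 4 - i)" "1 \<le> i" "i \<le> n - 4" by auto
      then have "n - i = (n - 4 - i) + 4" by simp
      with i False show ?thesis by (auto simp only: dvd_add_triv_right_iff)
    qed (use assms in simp)
  qed
  moreover have "finite ?B" by simp
  moreover have "n \<notin> ?B" using assms by simp
  ultimately show ?thesis by (simp add: S_def)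
qed

text \<open>The least value with leading summand \<open>+F n\<close> is \<open>F n - S (n - 3)\<close>. This identity says that it
  exceeds \<open>S (n - 1)\<close> by exactly one, so that the intervals belonging to consecutive leading
  indices abut. Truncated subtraction is harmless for small \<open>n\<close>, since \<open>S 0 = 0\<close>.\<close>

lemma F_eq_S:
  assumes "1 \<le> n"
  shows "F n = S (n - 1) + S (n - 3) + 1"
  using assms
proof (induction n rule: less_induct)
  case (less n)
  show ?case
  proof (cases "n \<le> 4")
    case True
    then have "n = 1 \<or> n = 2 \<or> n = 3 \<or> n = 4" using less.prems by auto
    then show ?thesis by (auto simp: S_step S_0 F_def eval_nat_numeral)
  next
    case False
    define k where "k = n - 5"
    have n: "n = k + 5" using False by (simp add: k_def)
    have "F (k + 1) = S k + S (k - 2) + 1" using less.IH[of "k + 1"] n by simp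
    moreover have "S (k + 4) = F (k + 4) + S k" "S (k + 2) = F (k + 2) + S (k - 2)"
      using S_step[of "k + 4"] S_step[of "k + 2"] by simp_all
    moreover have "F (k + 5) = F (k + 4) + F (k + 2) + F (k + 1)"
      by (simp add: F_def eval_nat_numeral)
    ultimately show ?thesis by (simp add: n add.commute)
  qed
qed

lemma F_pos: "0 < F n"
  by (simp add: F_def fib_neq_0_nat)

lemma S_nonneg: "0 \<le> S n"
  unfolding S_def by (rule sum_nonneg) (simp add: F_pos less_imp_le)

lemma S_mono: "m \<le> n \<Longrightarrow> S m \<le> S n"
proof (rule lift_Suc_mono_le[of S])
  fix n
  have "S n \<le> F (Suc n)" using F_eq_S[of "Suc n"] S_nonneg[of "n - 2"] by simp
  also have "\<dots> \<le> S (Suc n)" using S_step[of "Suc n"] S_nonneg[of "n - 3"] by simp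
  finally show "S n \<le> S (Suc n)" .
qed

text \<open>The remainder below the leading summand is bounded by induction: with the sign of \<open>F n\<close> it adds
  at most \<open>S (n - 4)\<close>, and with the opposite sign it takes away at most \<open>S (n - 3)\<close>.\<close>

lemma rep_value_bounds:
  assumes "r \<in> reps_with_top n s"
  shows "s * rep_value r \<in> {S (n - 1)<..S n}"
  using assms
proof (induction n arbitrary: r s rule: less_induct)
  case (less n)
  have n: "1 \<le> n" and s: "s = 1 \<or> s = -1"
    using less.prems spaced_last[of r n s] by (auto simp: reps_with_top_def)
  have bounds: "S (n - 1) < F n - S (n - 3)" "F n + S (n - 4) = S n"
    using F_eq_S[OF n] S_step[OF n] by auto
  consider "r = [(n, s)]"
    | p i where "r = p @ [(n, s)]" "p \<in> reps_with_top i (- s)" "i + 3 \<le> n"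
    | p i where "r = p @ [(n, s)]" "p \<in> reps_with_top i s" "i + 4 \<le> n"
    using less.prems reps_with_top_decompose[OF n, of s] s by auto
  then show ?case
  proof cases
    case 1
    then show ?thesis
      using s bounds S_nonneg[of "n - 3"] S_nonneg[of "n - 4"] by (auto simp: rep_value_def)
  next
    case 2
    have "- s * rep_value p \<in> {S (i - 1)<..S i}" using 2 by (intro less.IH) auto
    moreover have "S i \<le> S (n - 3)" using 2 by (intro S_mono) simp
    ultimately have "- S (n - 3) \<le> s * rep_value p" "s * rep_value p \<le> 0"
      using S_nonneg[of "i - 1"] by auto
    moreover have "s * rep_value r = s * rep_value p + F n" using s 2 by (auto simp: rep_value_def)
    ultimately show ?thesis using bounds S_nonneg[of "n - 4"] by auto
  next
    case 3
    have "s * rep_value p \<in> {S (i - 1)<..S i}" using 3 by (intro less.IH) auto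
    moreover have "S i \<le> S (n - 4)" using 3 by (intro S_mono) simp
    ultimately have "s * rep_value p \<le> S (n - 4)" "0 \<le> s * rep_value p"
      using S_nonneg[of "i - 1"] by auto
    moreover have "s * rep_value r = s * rep_value p + F n" using s 3 by (auto simp: rep_value_def)
    ultimately show ?thesis using bounds S_nonneg[of "n - 3"] by auto
  qed
qed

text \<open>The intervals \<open>(S (n - 1), S n]\<close> and their negatives are pairwise disjoint and omit 0, the
  value of the empty list. Thus the value of a representation determines its leading summand.\<close>

lemma rep_value_in_interval_iff:
  assumes "1 \<le> n" "spaced r"
  shows "rep_value r \<in> {S (n - 1)<..S n} \<longleftrightarrow> r \<in> reps_with_top n 1"
proof
  assume v: "rep_value r \<in> {S (n - 1)<..S n}"
  have "r \<noteq> []" using v S_nonneg[of "n - 1"] by (auto simp: rep_value_def)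
  obtain n' s where l: "last r = (n', s)" by fastforce
  have n': "1 \<le> n'" and s: "s = 1 \<or> s = -1" using spaced_last[OF assms(2) \<open>r \<noteq> []\<close> l] by auto
  have r: "r \<in> reps_with_top n' s" using assms(2) \<open>r \<noteq> []\<close> l by (simp add: reps_with_top_def)
  note b = rep_value_bounds[OF r]
  have "s = 1" using s b v S_nonneg[of "n' - 1"] S_nonneg[of "n - 1"] by auto
  moreover have "n' = n"
  proof (rule antisym; rule ccontr)
    assume "\<not> n' \<le> n"
    then have "S n \<le> S (n' - 1)" by (intro S_mono) simp
    then show False using b v \<open>s = 1\<close> by simp
  next
    assume "\<not> n \<le> n'"
    then have "S n' \<le> S (n - 1)" by (intro S_mono) simp
    then show False using b v \<open>s = 1\<close> by simp
  qed
  ultimately show "r \<in> reps_with_top n 1" using r by simp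
next
  assume "r \<in> reps_with_top n 1"
  from rep_value_bounds[OF this] show "rep_value r \<in> {S (n - 1)<..S n}" by simp
qed

section \<open>Summing over representations with a given leading summand\<close>

lemma finite_reps_with_top: "finite (reps_with_top n s)"
proof (induction n arbitrary: s rule: less_induct)
  case (less n)
  show ?case
  proof (cases "1 \<le> n \<and> s \<in> {-1, 1}")
    case True
    have "finite {i. i + 3 \<le> n}" "finite {i. i + 4 \<le> n}"
      by (auto intro: finite_subset[of _ "{..n}"])
    then show ?thesis
      unfolding reps_with_top_decompose[OF conjunct1[OF True] conjunct2[OF True]]
      using less.IH by auto
  next
    case False
    then have "reps_with_top n s = {}"
      using spaced_last by (fastforce simp: reps_with_top_def)
    then show ?thesis by simp
  qed
qed

text \<open>Changing all signs preserves the spacing condition. It reduces remainders with leading sign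
  \<open>-1\<close>, which appear in the recursion, to those with leading sign \<open>1\<close>.\<close>

definition flip_signs :: "(nat \<times> int) list \<Rightarrow> (nat \<times> int) list" where
  "flip_signs = map (\<lambda>(i, e). (i, - e))"

lemma flip_signs_flip_signs: "flip_signs (flip_signs r) = r"
  by (induction r) (auto simp: flip_signs_def)

lemma flip_signs_reps_with_top:
  assumes "r \<in> reps_with_top n s"
  shows "flip_signs r \<in> reps_with_top n (- s)"
proof -
  have "spaced (flip_signs r)"
    using assms unfolding reps_with_top_def spaced_def flip_signs_def
    by (auto simp: sorted_wrt_map case_prod_unfold)
  then show ?thesis using assms by (auto simp: reps_with_top_def flip_signs_def last_map)
qed

lemma sum_flip_signs:
  fixes f :: "(nat \<times> int) list \<Rightarrow> nat"
  assumes "\<And>r. f (flip_signs r) = f r"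
  shows "(\<Sum>r\<in>reps_with_top n (- s). f r) = (\<Sum>r\<in>reps_with_top n s. f r)"
  by (rule sum.reindex_bij_witness[of _ flip_signs flip_signs])
     (use flip_signs_reps_with_top[of _ n "- s"] flip_signs_reps_with_top[of _ n s]
      in \<open>auto simp: flip_signs_flip_signs assms\<close>)

text \<open>Every recursion below is an instance of this one, obtained by choosing \<open>f\<close> constant, or the
  number of summands, or the number of gaps of a given length.\<close>

lemma sum_reps_with_top:
  fixes f :: "(nat \<times> int) list \<Rightarrow> nat"
  assumes "1 \<le> n"
  shows "(\<Sum>r\<in>reps_with_top n 1. f r) = f [(n, 1)] +
    (\<Sum>i | i + 3 \<le> n. \<Sum>r\<in>reps_with_top i (- 1). f (r @ [(n, 1)])) +
    (\<Sum>i | i + 4 \<le> n. \<Sum>r\<in>reps_with_top i 1. f (r @ [(n, 1)]))"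
proof -
  let ?snoc = "\<lambda>r. r @ [(n, 1)]"
  let ?A = "\<Union>i\<in>{i. i + 3 \<le> n}. reps_with_top i (- 1)"
  let ?B = "\<Union>i\<in>{i. i + 4 \<le> n}. reps_with_top i 1"
  have fin: "finite {i. i + 3 \<le> n}" "finite {i. i + 4 \<le> n}"
    by (auto intro: finite_subset[of _ "{..n}"])
  have finAB: "finite ?A" "finite ?B" using fin finite_reps_with_top by auto
  have disj: "?A \<inter> ?B = {}" by (auto simp: reps_with_top_def)
  have "[(n, 1)] \<notin> ?snoc ` (?A \<union> ?B)" by (auto simp: reps_with_top_def)
  then have "(\<Sum>r\<in>reps_with_top n 1. f r) = f [(n, 1)] + (\<Sum>r\<in>?snoc ` (?A \<union> ?B). f r)"
    using reps_with_top_decompose[OF assms, of 1] finAB by simp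
  also have "(\<Sum>r\<in>?snoc ` (?A \<union> ?B). f r) = (\<Sum>r\<in>?A \<union> ?B. f (?snoc r))"
    by (subst sum.reindex) (auto simp: inj_on_def)
  also have "\<dots> = (\<Sum>r\<in>?A. f (?snoc r)) + (\<Sum>r\<in>?B. f (?snoc r))"
    using finAB disj by (rule sum.union_disjoint)
  also have "(\<Sum>r\<in>?A. f (?snoc r)) =
      (\<Sum>i | i + 3 \<le> n. \<Sum>r\<in>reps_with_top i (- 1). f (?snoc r))"
    using fin finite_reps_with_top by (intro sum.UNION_disjoint) (auto simp: reps_with_top_def)
  also have "(\<Sum>r\<in>?B. f (?snoc r)) =
      (\<Sum>i | i + 4 \<le> n. \<Sum>r\<in>reps_with_top i 1. f (?snoc r))"
    using fin finite_reps_with_top by (intro sum.UNION_disjoint) (auto simp: reps_with_top_def)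
  finally show ?thesis by simp
qed

section \<open>Counting gaps by their length\<close>

definition num_reps :: "nat \<Rightarrow> nat" where
  "num_reps n = card (reps_with_top n 1)"

definition num_summands :: "nat \<Rightarrow> nat" where
  "num_summands n = (\<Sum>r\<in>reps_with_top n 1. length r)"

definition gaps_in :: "nat \<Rightarrow> (nat \<times> int) list \<Rightarrow> nat" where
  "gaps_in j r = card {k. Suc k < length r \<and> fst (r ! Suc k) - fst (r ! k) = j}"

definition num_gaps :: "nat \<Rightarrow> nat \<Rightarrow> nat" where
  "num_gaps j n = (\<Sum>r\<in>reps_with_top n 1. gaps_in j r)"

lemma gaps_in_snoc:
  assumes "r \<noteq> []" "last r = (i, e)"
  shows "gaps_in j (r @ [(n, s)]) = gaps_in j r + of_bool (n - i = j)"
proof -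
  let ?K = "\<lambda>r. {k. Suc k < length r \<and> fst (r ! Suc k) - fst (r ! k) = j}"
  obtain p where r: "r = p @ [(i, e)]"
    using assms by (metis append_butlast_last_id)
  have "?K (r @ [(n, s)]) = ?K r \<union> (if n - i = j then {length p} else {})"
    by (auto simp: r nth_append less_Suc_eq split: if_splits)
  moreover have "finite (?K r)" by (rule finite_subset[of _ "{..length r}"]) auto
  moreover have "length p \<notin> ?K r" by (simp add: r)
  ultimately show ?thesis by (auto simp: gaps_in_def)
qed

lemma gaps_in_flip_signs: "gaps_in j (flip_signs r) = gaps_in j r"
proof -
  have "fst (flip_signs r ! k) = fst (r ! k)" if "k < length r" for k
    using that by (simp add: flip_signs_def case_prod_beta)
  then show ?thesis
    unfolding gaps_in_def by (intro arg_cong[of _ _ card]) (auto simp: flip_signs_def)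
qed

lemma num_0: "num_reps 0 = 0" "num_summands 0 = 0" "num_gaps j 0 = 0"
  by (simp_all add: num_reps_def num_summands_def num_gaps_def reps_with_top_0)

lemma num_flip_signs:
  "card (reps_with_top n (- 1)) = num_reps n"
  "(\<Sum>r\<in>reps_with_top n (- 1). length r) = num_summands n"
  "(\<Sum>r\<in>reps_with_top n (- 1). gaps_in j r) = num_gaps j n"
  using sum_flip_signs[of "\<lambda>_. 1" n 1] sum_flip_signs[of length n 1]
    sum_flip_signs[of "gaps_in j" n 1]
  by (simp_all add: num_reps_def num_summands_def num_gaps_def gaps_in_flip_signs)
     (simp add: flip_signs_def)

lemma num_reps_rec:
  assumes "1 \<le> n"
  shows "num_reps n = 1 + (\<Sum>i | i + 3 \<le> n. num_reps i) + (\<Sum>i | i + 4 \<le> n. num_reps i)"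
  using sum_reps_with_top[OF assms, of "\<lambda>_. 1"] num_flip_signs(1)
  by (simp add: num_reps_def)

lemma num_summands_rec:
  "num_summands n =
    num_reps n + (\<Sum>i | i + 3 \<le> n. num_summands i) + (\<Sum>i | i + 4 \<le> n. num_summands i)"
proof (cases "n = 0")
  case False
  then have "1 \<le> n" by simp
  then show ?thesis
    unfolding num_reps_rec[OF \<open>1 \<le> n\<close>]
    using sum_reps_with_top[OF \<open>1 \<le> n\<close>, of length] num_flip_signs(1,2)
    by (simp add: num_reps_def num_summands_def sum_Suc sum.distrib)
qed (simp add: num_0)

text \<open>The number of signs allowed at one end of a gap of length \<open>j\<close> when the other sign is given.\<close>

definition sign_choices :: "nat \<Rightarrow> nat" where
  "sign_choices j = of_bool (3 \<le> j) + of_bool (4 \<le> j)"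

lemma sum_num_reps_at_distance:
  "(\<Sum>i | i + d \<le> n. num_reps i * of_bool (n - i = j)) = of_bool (d \<le> j \<and> j \<le> n) * num_reps (n - j)"
proof -
  have "(\<Sum>i | i + d \<le> n. num_reps i * of_bool (n - i = j)) =
        (\<Sum>i | i + d \<le> n. if i = n - j then of_bool (j \<le> n) * num_reps (n - j) else 0)"
    by (rule sum.cong) auto
  also have "\<dots> = of_bool (d \<le> j \<and> j \<le> n) * num_reps (n - j)"
  proof -
    have "finite {i. i + d \<le> n}" by (rule finite_subset[of _ "{..n}"]) auto
    then show ?thesis by (auto simp: sum.delta)
  qed
  finally show ?thesis .
qed

text \<open>The inhomogeneous term counts leading gaps of length \<open>j\<close>; all other gaps lie in the remainder.\<close>

lemma num_gaps_rec:
  assumes "1 \<le> n"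
  shows "num_gaps j n = of_bool (j \<le> n) * sign_choices j * num_reps (n - j) +
    (\<Sum>i | i + 3 \<le> n. num_gaps j i) + (\<Sum>i | i + 4 \<le> n. num_gaps j i)"
proof -
  have snoc: "(\<Sum>r\<in>reps_with_top i e. gaps_in j (r @ [(n, 1)])) =
      (\<Sum>r\<in>reps_with_top i e. gaps_in j r) + card (reps_with_top i e) * of_bool (n - i = j)" for i e
  proof -
    have "(\<Sum>r\<in>reps_with_top i e. gaps_in j (r @ [(n, 1)])) =
          (\<Sum>r\<in>reps_with_top i e. gaps_in j r + of_bool (n - i = j))"
      by (rule sum.cong) (auto simp: reps_with_top_def gaps_in_snoc)
    then show ?thesis by (simp add: sum.distrib)
  qed
  have "num_gaps j n = (\<Sum>i | i + 3 \<le> n. num_gaps j i + num_reps i * of_bool (n - i = j)) +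
      (\<Sum>i | i + 4 \<le> n. num_gaps j i + num_reps i * of_bool (n - i = j))"
    using sum_reps_with_top[OF assms, of "gaps_in j"]
    by (simp only: snoc num_flip_signs num_gaps_def[symmetric] num_reps_def[symmetric])
       (simp add: gaps_in_def)
  then show ?thesis
    unfolding sum.distrib sum_num_reps_at_distance
    by (simp add: sign_choices_def algebra_simps)
qed

text \<open>Both sides solve the same recursion: by \<open>num_gaps_rec\<close>, the gap count is driven by
  \<open>num_reps\<close> shifted by \<open>j\<close> and scaled, whereas \<open>num_summands\<close> is driven by \<open>num_reps\<close> itself.
  Combinatorially, a gap of length \<open>j\<close> is contracted by identifying its two ends, after changing
  the signs below it if the ends have opposite signs. This gives a marked summand in a
  representation with leading index \<open>n - j\<close>, and \<open>sign_choices j\<close> gaps contract to the same one.\<close>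

lemma num_gaps_eq:
  "num_gaps j n = of_bool (j \<le> n) * sign_choices j * num_summands (n - j)"
proof (induction n rule: less_induct)
  case (less n)
  show ?case
  proof (cases "n = 0")
    case True
    then show ?thesis by (simp add: num_0)
  next
    case False
    have shift: "(\<Sum>i | i + d \<le> n. num_gaps j i) =
        of_bool (j \<le> n) * sign_choices j * (\<Sum>i | i + d \<le> n - j. num_summands i)" if "1 \<le> d" for d
    proof (cases "j \<le> n")
      case True
      have fin: "finite {i. i + d \<le> n}" by (rule finite_subset[of _ "{..n}"]) auto
      have "(\<Sum>i | i + d \<le> n. num_gaps j i) =
          (\<Sum>i | i + d \<le> n. of_bool (j \<le> i) * sign_choices j * num_summands (i - j))"
        using that by (intro sum.cong less.IH) auto
      also have "\<dots> = (\<Sum>i\<in>{i. i + d \<le> n \<and> j \<le> i}. sign_choices j * num_summands (i - j))"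
        using fin by (intro sum.mono_neutral_cong_right) auto
      also have "\<dots> = (\<Sum>i | i + d \<le> n - j. sign_choices j * num_summands i)"
        by (rule sum.reindex_bij_witness[of _ "\<lambda>i. i + j" "\<lambda>i. i - j"]) (use True in auto)
      finally show ?thesis using True by (simp add: sum_distrib_left)
    next
      case False
      then show ?thesis using that less.IH by auto
    qed
    have "1 \<le> n" using False by simp
    show ?thesis
      unfolding num_gaps_rec[OF \<open>1 \<le> n\<close>] shift[of 3, simplified] shift[of 4, simplified]
      num_summands_rec[of "n - j"] by (simp add: algebra_simps)
  qed
qed

text \<open>The integer recorded in a gap is determined by the list, so gaps are just marked positions in the
  lists with leading summand \<open>+F n\<close>.\<close>

lemma gaps_eq:
  assumes "1 \<le> n"
  shows "gaps n =
    (\<lambda>(r, k). (rep_value r, r, k)) ` (SIGMA r:reps_with_top n 1. {k. Suc k < length r})"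
proof -
  have "(m, r, k) \<in> gaps n \<longleftrightarrow>
      r \<in> reps_with_top n 1 \<and> m = rep_value r \<and> Suc k < length r" for m r k
    using rep_value_in_interval_iff[OF assms, of r]
    by (auto simp: gaps_def far_difference_rep_iff reps_with_top_def)
  then show ?thesis by (auto simp: image_iff)
qed

lemma card_gaps:
  assumes "1 \<le> n"
  shows "real (card (gaps n)) = real (num_summands n) - real (num_reps n)"
    and "card {g \<in> gaps n. gap_length g = j} = num_gaps j n"
proof -
  let ?emb = "\<lambda>(r, k). (rep_value r, r, k :: nat)"
  have inj: "inj_on ?emb A" for A by (auto simp: inj_on_def)
  have fin: "finite {k. Suc k < length r}" for r :: "(nat \<times> int) list"
    by (rule finite_subset[of _ "{..length r}"]) auto
  have len: "card {k. Suc k < length r} = length r - 1" for r :: "(nat \<times> int) list"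
  proof -
    have "{k. Suc k < length r} = {..<length r - 1}" by auto
    then show ?thesis by simp
  qed
  have "card (gaps n) = (\<Sum>r\<in>reps_with_top n 1. length r - 1)"
    unfolding gaps_eq[OF assms] card_image[OF inj]
    by (simp add: finite_reps_with_top fin len)
  moreover have "(\<Sum>r\<in>reps_with_top n 1. real (length r - 1)) =
      (\<Sum>r\<in>reps_with_top n 1. real (length r) - 1)"
    by (rule sum.cong) (auto simp: reps_with_top_def of_nat_diff Suc_le_eq)
  ultimately show "real (card (gaps n)) = real (num_summands n) - real (num_reps n)"
    by (simp add: num_summands_def num_reps_def sum_subtractf)
  have fin_j: "finite {k. Suc k < length r \<and> fst (r ! Suc k) - fst (r ! k) = j}"
    for r :: "(nat \<times> int) list"
    by (rule finite_subset[OF _ fin[of r]]) auto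
  have "{g \<in> gaps n. gap_length g = j} = ?emb ` (SIGMA r:reps_with_top n 1.
      {k. Suc k < length r \<and> fst (r ! Suc k) - fst (r ! k) = j})"
    unfolding gaps_eq[OF assms] by (auto simp: gap_length_def)
  then show "card {g \<in> gaps n. gap_length g = j} = num_gaps j n"
    by (simp add: card_image[OF inj] finite_reps_with_top fin_j num_gaps_def gaps_in_def)
qed

lemma gap_prob_eq:
  assumes "1 \<le> n"
  shows "gap_prob (n + j) j =
    sign_choices j * num_summands n / (num_summands (n + j) - real (num_reps (n + j)))"
  using card_gaps[of "n + j"] assms by (simp add: gap_prob_def num_gaps_eq)

section \<open>Growth of the counts\<close>

abbreviation phi :: real ("\<phi>") where "\<phi> \<equiv> golden_mean"

lemma golden_mean_square: "\<phi>\<^sup>2 = \<phi> + 1"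
  by (simp add: golden_mean_def power2_eq_square field_simps)

lemma golden_mean_gt_1: "1 < \<phi>"
proof -
  have "sqrt 1 < sqrt 5" by (subst real_sqrt_less_iff) simp
  then show ?thesis by (simp add: golden_mean_def)
qed

lemma golden_mean_power_add:
  "\<phi> ^ (n + 2) = \<phi> ^ (n + 1) + \<phi> ^ n"
  unfolding power_add golden_mean_square by (simp add: algebra_simps)

lemma golden_mean_power_rec: "\<phi> ^ (n + 4) = \<phi> ^ (n + 3) + \<phi> ^ (n + 1) + \<phi> ^ n"
  using golden_mean_power_add[of n] golden_mean_power_add[of "n + 1"]
    golden_mean_power_add[of "n + 2"]
  by (simp add: eval_nat_numeral)

lemma sum_shift:
  fixes f :: "nat \<Rightarrow> nat"
  shows "(\<Sum>i | i + 3 \<le> n + 4. f i) + (\<Sum>i | i + 4 \<le> n + 4. f i) =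
    (\<Sum>i | i + 3 \<le> n + 3. f i) + (\<Sum>i | i + 4 \<le> n + 3. f i) + f (n + 1) + f n"
proof -
  have "{i. i + 3 \<le> n + 4} = insert (n + 1) {i. i + 3 \<le> n + 3}"
       "{i. i + 4 \<le> n + 4} = insert n {i. i + 4 \<le> n + 3}" by auto
  moreover have "finite {i. i + 3 \<le> n + 3}" "finite {i. i + 4 \<le> n + 3}"
    by (auto intro: finite_subset[of _ "{..n}"])
  ultimately show ?thesis by simp
qed

text \<open>Subtracting the summation recursions at two consecutive arguments leaves recursions of order
  four, which \<open>\<phi> ^ n\<close> also satisfies by \<open>golden_mean_power_rec\<close>; growth bounds then propagate by
  induction.\<close>

lemma num_reps_linear_rec:
  "num_reps (n + 4) = num_reps (n + 3) + num_reps (n + 1) + num_reps n"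
  using num_reps_rec[of "n + 4"] num_reps_rec[of "n + 3"] sum_shift[of num_reps n] by simp

lemma num_summands_linear_rec:
  "num_summands (n + 4) = num_summands (n + 3) + num_summands (n + 1) + num_summands n +
    num_reps (n + 1) + num_reps n"
  using num_summands_rec[of "n + 4"] num_summands_rec[of "n + 3"] sum_shift[of num_summands n]
    num_reps_linear_rec[of n] by simp

lemma num_reps_small: "num_reps 1 = 1" "num_reps 2 = 1" "num_reps 3 = 1"
proof -
  have "{i. i + 3 \<le> (3::nat)} = {0}" by auto
  then show "num_reps 1 = 1" "num_reps 2 = 1" "num_reps 3 = 1"
    using num_reps_rec[of 1] num_reps_rec[of 2] num_reps_rec[of 3] by (simp_all add: num_0)
qed

lemma four_step_induct [case_names small step]:
  assumes "\<And>n. n < 4 \<Longrightarrow> P n"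
    and "\<And>n. P n \<Longrightarrow> P (n + 1) \<Longrightarrow> P (n + 2) \<Longrightarrow> P (n + 3) \<Longrightarrow> P (n + 4)"
  shows "P (n :: nat)"
proof (induction n rule: less_induct)
  case (less n)
  show ?case
  proof (cases "n < 4")
    case False
    then have "P (n - 4 + 4)" by (intro assms(2) less.IH) auto
    then show ?thesis using False by simp
  qed (rule assms(1))
qed

lemma num_reps_le: "num_reps n \<le> \<phi> ^ n"
proof (induction n rule: four_step_induct)
  case (small n)
  then have "n = 0 \<or> n = 1 \<or> n = 2 \<or> n = 3" by auto
  then have "real (num_reps n) \<le> 1" using num_reps_small num_0 by auto
  also have "(1::real) \<le> \<phi> ^ n" using golden_mean_gt_1 by simp
  finally show ?case by simp
next
  case (step n)
  then show ?case using golden_mean_power_rec[of n] num_reps_linear_rec[of n] by simp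
qed

lemma num_reps_ge: "\<phi> ^ n \<le> \<phi> ^ 3 * num_reps (n + 1)"
proof (induction n rule: four_step_induct)
  case (small n)
  have "num_reps 4 = 2" using num_reps_linear_rec[of 0] num_reps_small num_0 by simp
  moreover have "n + 1 = 1 \<or> n + 1 = 2 \<or> n + 1 = 3 \<or> n + 1 = 4" using small by auto
  ultimately have "1 \<le> num_reps (n + 1)" using num_reps_small by (elim disjE) (simp_all only:)
  then have "\<phi> ^ 3 * 1 \<le> \<phi> ^ 3 * num_reps (n + 1)"
    using golden_mean_gt_1 by (intro mult_left_mono) auto
  moreover have "\<phi> ^ n \<le> \<phi> ^ 3" using small golden_mean_gt_1 by (intro power_increasing) auto
  ultimately show ?case by simp
next
  case (step n)
  have "num_reps (n + 4 + 1) = num_reps (n + 3 + 1) + num_reps (n + 1 + 1) + num_reps (n + 1)"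
    using num_reps_linear_rec[of "n + 1"] by (simp add: add.commute add.left_commute)
  then have "\<phi> ^ 3 * num_reps (n + 4 + 1) =
     \<phi> ^ 3 * num_reps (n + 3 + 1) + \<phi> ^ 3 * num_reps (n + 1 + 1) + \<phi> ^ 3 * num_reps (n + 1)"
    by (simp add: distrib_left)
  then show ?case using step golden_mean_power_rec[of n] by linarith
qed

text \<open>The terms in \<open>num_reps\<close> are a driving term of the order of \<open>\<phi> ^ n\<close> in a recursion whose
  homogeneous solutions grow at the same rate. This resonance produces the additional factor \<open>n\<close>.\<close>

lemma num_summands_ge:
  "\<exists>c>0. \<forall>n. c * n * \<phi> ^ n \<le> num_summands n"
proof -
  \<comment> \<open>Inserting \<open>n * \<phi> ^ n\<close> into the recursion leaves the defect
      \<open>(\<phi> ^ 3 + 3 * \<phi> + 4) * \<phi> ^ n\<close>, which \<open>c\<close> scales below the driving term, itself bounded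
      below by \<open>num_reps_ge\<close>.\<close>
  define c where "c = 1 / (\<phi> ^ 3 * (\<phi> ^ 3 + 3 * \<phi> + 4))"
  have pos: "0 < \<phi> ^ 3 + 3 * \<phi> + 4" "0 < \<phi> ^ 3"
    using golden_mean_gt_1 by (auto intro!: add_pos_pos)
  have c: "0 < c" "c * (\<phi> ^ 3 * (\<phi> ^ 3 + 3 * \<phi> + 4)) = 1"
    using pos by (simp_all add: c_def)
  have "c * n * \<phi> ^ n \<le> num_summands n" for n :: nat
  proof (induction n rule: four_step_induct)
    case (small n)
    show ?case
    proof (cases "n = 0")
      case False
      have "n = 1 \<or> n = 2 \<or> n = 3" using small False by auto
      then have "num_reps n = 1" using num_reps_small by (elim disjE) (simp_all only:)
      then have "1 \<le> real (num_summands n)" using num_summands_rec[of n] by linarith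
      moreover have "c * n * \<phi> ^ n \<le> c * 4 * \<phi> ^ 3"
        using small c golden_mean_gt_1 by (intro mult_mono power_increasing) auto
      moreover have "c * 4 * \<phi> ^ 3 \<le> 1"
      proof -
        have "c * \<phi> ^ 3 * 4 \<le> c * \<phi> ^ 3 * (\<phi> ^ 3 + 3 * \<phi> + 4)"
          using c pos golden_mean_gt_1 by (intro mult_left_mono) auto
        then show ?thesis using c by (simp add: mult.assoc mult.left_commute)
      qed
      ultimately show ?thesis by linarith
    qed simp
  next
    case (step n)
    have "c * (n + 4) * \<phi> ^ (n + 4) = c * (n + 3) * \<phi> ^ (n + 3) + c * (n + 1) * \<phi> ^ (n + 1)
        + c * n * \<phi> ^ n + c * (\<phi> ^ 3 + 3 * \<phi> + 4) * \<phi> ^ n"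
      unfolding golden_mean_power_rec by (simp add: algebra_simps power_add)
    moreover have "c * (\<phi> ^ 3 + 3 * \<phi> + 4) * \<phi> ^ n \<le> num_reps (n + 1)"
    proof -
      have "c * (\<phi> ^ 3 + 3 * \<phi> + 4) * \<phi> ^ n \<le>
            c * (\<phi> ^ 3 + 3 * \<phi> + 4) * (\<phi> ^ 3 * num_reps (n + 1))"
        using c pos by (intro mult_left_mono num_reps_ge) auto
      also have "\<dots> = c * (\<phi> ^ 3 * (\<phi> ^ 3 + 3 * \<phi> + 4)) * num_reps (n + 1)"
        by (simp add: algebra_simps)
      finally show ?thesis using c by simp
    qed
    ultimately show ?case using step num_summands_linear_rec[of n] by simp
  qed
  then show ?thesis using c by blast
qed

text \<open>The factors of the characteristic polynomial are peeled off one at a time. With \<open>c\<close> for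
  \<open>num_summands\<close>, the difference \<open>E n = c (n + 2) - c (n + 1) - c n\<close> removes the roots of \<open>x\<^sup>2 - x - 1\<close>, so that it satisfies the
  recursion belonging to \<open>x\<^sup>2 + 1\<close> up to a driving term of order \<open>\<phi> ^ n\<close>. The quantity to be bounded
  satisfies the recursion belonging to the other root \<open>1 - \<phi>\<close> of \<open>x\<^sup>2 - x - 1\<close>, driven by \<open>E\<close>. All
  these roots have modulus at most 1, less than \<open>\<phi>\<close>, so the order \<open>\<phi> ^ n\<close> survives both steps;
  there is no factor \<open>n\<close>.\<close>

lemma num_summands_step:
  "\<exists>H. \<forall>n. \<bar>num_summands (n + 1) - \<phi> * num_summands n\<bar> \<le> H * \<phi> ^ n"
proof -
  define x where "x n = real (num_summands n)" for n
  define E where "E n = x (n + 2) - x (n + 1) - x n" for n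
  define h where "h n = x (n + 1) - \<phi> * x n" for n
  have phi: "\<phi> * \<phi> = \<phi> + 1" "1 < \<phi>"
    using golden_mean_square golden_mean_gt_1 by (simp_all add: power2_eq_square)
  have E_rec: "E (n + 2) = real (num_reps (n + 1)) + real (num_reps n) - E n" for n
    using num_summands_linear_rec[of n] by (simp add: E_def x_def eval_nat_numeral)
  \<comment> \<open>The summand \<open>\<phi>\<close> makes \<open>\<phi> * \<phi> \<le> \<phi> * K\<close>, which absorbs the driving term; the others
      start the induction.\<close>
  define K where "K = \<phi> + \<bar>E 0\<bar> + \<bar>E 1\<bar>"
  have E_bound: "\<bar>E n\<bar> \<le> K * \<phi> ^ n \<and> \<bar>E (n + 1)\<bar> \<le> K * \<phi> ^ (n + 1)" for n
  proof (induction n)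
    case 0
    have "K * 1 \<le> K * \<phi>" using phi by (intro mult_left_mono) (auto simp: K_def)
    then show ?case using phi by (auto simp: K_def)
  next
    case (Suc n)
    have "\<bar>E (n + 2)\<bar> \<le> num_reps (n + 1) + num_reps n + \<bar>E n\<bar>"
      unfolding E_rec by linarith
    also have "\<dots> \<le> \<phi> ^ (n + 1) + \<phi> ^ n + K * \<phi> ^ n"
      using num_reps_le[of n] num_reps_le[of "n + 1"] Suc by linarith
    also have "\<dots> = (\<phi> * \<phi> + K) * \<phi> ^ n" using phi by (simp add: algebra_simps)
    also have "\<dots> \<le> (\<phi> * K + K) * \<phi> ^ n"
      using phi by (intro mult_right_mono add_mono mult_left_mono) (auto simp: K_def)
    also have "\<dots> = K * (\<phi> * \<phi>) * \<phi> ^ n" unfolding phi by (simp add: algebra_simps)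
    also have "\<dots> = K * \<phi> ^ (n + 2)" by (simp add: power_add power2_eq_square)
    finally show ?case using Suc by simp
  qed
  define H where "H = K + \<bar>h 0\<bar>"
  have h_rec: "h (n + 1) = E n - (\<phi> - 1) * h n" for n
  proof -
    have "(\<phi> - 1) * h n = (\<phi> - 1) * x (n + 1) - (\<phi> * \<phi> - \<phi>) * x n"
      by (simp add: h_def algebra_simps)
    also have "\<dots> = (\<phi> - 1) * x (n + 1) - x n" unfolding phi by simp
    finally show ?thesis by (simp add: h_def E_def algebra_simps)
  qed
  have "\<bar>h n\<bar> \<le> H * \<phi> ^ n" for n
  proof (induction n)
    case 0
    then show ?case using phi by (simp add: H_def K_def)
  next
    case (Suc n)
    have "\<bar>h (n + 1)\<bar> \<le> \<bar>E n\<bar> + (\<phi> - 1) * \<bar>h n\<bar>"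
      unfolding h_rec using phi abs_triangle_ineq4[of "E n" "(\<phi> - 1) * h n"] by (simp add: abs_mult)
    also have "\<dots> \<le> H * \<phi> ^ n + (\<phi> - 1) * (H * \<phi> ^ n)"
    proof (intro add_mono mult_left_mono Suc)
      have "K * \<phi> ^ n \<le> H * \<phi> ^ n" using phi by (intro mult_right_mono) (auto simp: H_def)
      then show "\<bar>E n\<bar> \<le> H * \<phi> ^ n" using E_bound[of n] by linarith
    qed (use phi in auto)
    also have "\<dots> = H * \<phi> ^ Suc n" by (simp add: algebra_simps)
    finally show ?case by simp
  qed
  then show ?thesis unfolding h_def x_def by blast
qed

lemma num_summands_dominates: "(\<lambda>n. \<phi> ^ n / num_summands n) \<longlonglongrightarrow> 0"
proof -
  obtain c where c: "0 < c" "\<And>n. c * n * \<phi> ^ n \<le> num_summands n"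
    using num_summands_ge by blast
  have "\<forall>\<^sub>F n in sequentially. norm (\<phi> ^ n / num_summands n) \<le> norm (1 / real n) * (1 / c)"
    using eventually_gt_at_top[of 0]
  proof eventually_elim
    case (elim n)
    have "0 < \<phi> ^ n" using golden_mean_gt_1 by simp
    then have "0 < c * n * \<phi> ^ n" using c(1) elim by simp
    then have "\<phi> ^ n / num_summands n \<le> \<phi> ^ n / (c * n * \<phi> ^ n)"
      using c(2)[of n] \<open>0 < \<phi> ^ n\<close> by (intro divide_left_mono mult_pos_pos[of _ "c * n * \<phi> ^ n"]) linarith+
    then show ?case using \<open>0 < \<phi> ^ n\<close> golden_mean_gt_1 by (simp add: mult.commute)
  qed
  then show ?thesis by (rule tendsto_0_le[OF lim_1_over_n])
qed

lemma num_summands_pos: "1 \<le> n \<Longrightarrow> 0 < num_summands n"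
  using num_summands_rec[of n] num_reps_rec[of n] by simp

text \<open>With \<open>c\<close> for \<open>num_summands\<close>: in one step, the error \<open>c (n + 1) - \<phi> * c n\<close> has order \<open>\<phi> ^ n\<close>, which is negligible against
  \<open>c n\<close>. The general case telescopes.\<close>

lemma num_summands_ratio: "(\<lambda>n. num_summands n / real (num_summands (n + j))) \<longlonglongrightarrow> 1 / \<phi> ^ j"
proof (induction j)
  case 0
  have "\<forall>\<^sub>F n in sequentially. 1 = num_summands n / real (num_summands (n + 0))"
    using eventually_ge_at_top[of 1] by eventually_elim (use num_summands_pos in force)
  from tendsto_cong[OF this, of 1] show ?case by simp
next
  case (Suc j)
  obtain H where H: "\<And>n. \<bar>num_summands (n + 1) - \<phi> * num_summands n\<bar> \<le> H * \<phi> ^ n"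
    using num_summands_step by blast
  have "(\<lambda>n. num_summands (n + 1) / num_summands n - \<phi>) \<longlonglongrightarrow> 0"
  proof (rule tendsto_0_le[OF num_summands_dominates])
    show "\<forall>\<^sub>F n in sequentially. norm (num_summands (n + 1) / num_summands n - \<phi>) \<le>
        norm (\<phi> ^ n / num_summands n) * H"
      using eventually_ge_at_top[of 1]
    proof eventually_elim
      case (elim n)
      have pos: "0 < real (num_summands n)" using num_summands_pos[OF elim] by simp
      then have "num_summands (n + 1) / num_summands n - \<phi> =
          (num_summands (n + 1) - \<phi> * num_summands n) / num_summands n"
        by (simp add: field_simps)
      then show ?case
        using H[of n] pos golden_mean_gt_1 by (simp add: abs_divide divide_right_mono mult.commute)
    qed
  qed
  then have "(\<lambda>n. num_summands (n + 1) / num_summands n) \<longlonglongrightarrow> \<phi>"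
    by (simp add: LIM_zero_iff)
  then have "(\<lambda>n. inverse (num_summands (n + j + 1) / num_summands (n + j))) \<longlonglongrightarrow> inverse \<phi>"
    using golden_mean_gt_1 by (intro tendsto_inverse LIMSEQ_ignore_initial_segment) auto
  from tendsto_mult[OF Suc this]
  have "(\<lambda>n. num_summands n / real (num_summands (n + j)) *
      inverse (num_summands (n + j + 1) / num_summands (n + j))) \<longlonglongrightarrow> 1 / \<phi> ^ Suc j"
    by (simp add: field_simps)
  moreover have "\<forall>\<^sub>F n in sequentially. num_summands n / real (num_summands (n + j)) *
      inverse (num_summands (n + j + 1) / num_summands (n + j)) =
      num_summands n / real (num_summands (n + Suc j))"
    using eventually_ge_at_top[of 1]
  proof eventually_elim
    case (elim n)
    then have "0 < num_summands (n + j)" by (intro num_summands_pos) simp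
    then show ?case by (simp add: field_simps)
  qed
  ultimately show ?case using tendsto_cong by fast
qed

lemma gap_prob_tendsto: "(\<lambda>n. gap_prob n j) \<longlonglongrightarrow> sign_choices j / \<phi> ^ j"
proof -
  have "(\<lambda>n. num_reps n / num_summands n) \<longlonglongrightarrow> 0"
  proof (rule tendsto_0_le[OF num_summands_dominates])
    show "\<forall>\<^sub>F n in sequentially. norm (num_reps n / num_summands n) \<le>
        norm (\<phi> ^ n / num_summands n) * 1"
      using num_reps_le golden_mean_gt_1 by (intro always_eventually allI) (simp add: divide_right_mono)
  qed
  then have "(\<lambda>n. num_reps (n + j) / num_summands (n + j)) \<longlonglongrightarrow> 0"
    by (rule LIMSEQ_ignore_initial_segment)
  then have "(\<lambda>n. sign_choices j * (num_summands n / real (num_summands (n + j))) /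
      (1 - num_reps (n + j) / num_summands (n + j))) \<longlonglongrightarrow> sign_choices j * (1 / \<phi> ^ j) / (1 - 0)"
    by (intro tendsto_intros num_summands_ratio) auto
  moreover have "\<forall>\<^sub>F n in sequentially. sign_choices j * (num_summands n / real (num_summands (n + j))) /
      (1 - num_reps (n + j) / num_summands (n + j)) = gap_prob (n + j) j"
    using eventually_ge_at_top[of 1]
  proof eventually_elim
    case (elim n)
    then have "0 < num_summands (n + j)" by (intro num_summands_pos) simp
    then have "1 - num_reps (n + j) / num_summands (n + j) =
        (num_summands (n + j) - real (num_reps (n + j))) / num_summands (n + j)"
      by (simp add: diff_divide_distrib)
    then show ?case using gap_prob_eq[OF elim, of j] \<open>0 < num_summands (n + j)\<close> by simp
  qed
  ultimately have "(\<lambda>n. gap_prob (n + j) j) \<longlonglongrightarrow> sign_choices j / \<phi> ^ j"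
    using tendsto_cong by fastforce
  then show ?thesis by (rule LIMSEQ_offset)
qed

text \<open>Both sides equal \<open>3 * \<phi> + 1\<close>. This turns the constants of the theorem into \<open>1 / \<phi> ^ 3\<close> and
  \<open>2 / \<phi> ^ j\<close>.\<close>

lemma golden_mean_power_4: "\<phi> ^ 4 - 1 = 5 * a1 * \<phi>"
proof -
  have "5 * a1 = sqrt 5 * \<phi>" by (simp add: a1_def field_simps)
  moreover have "sqrt 5 = 2 * \<phi> - 1" by (simp add: golden_mean_def field_simps)
  ultimately have "5 * a1 * \<phi> = (2 * \<phi> - 1) * \<phi> * \<phi>" by simp
  then have "5 * a1 * \<phi> = 2 * \<phi> ^ 3 - \<phi> ^ 2" by (simp add: eval_nat_numeral algebra_simps)
  then show ?thesis
    using golden_mean_power_add[of 0] golden_mean_power_add[of 1] golden_mean_power_add[of 2]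
    by (simp add: eval_nat_numeral)
qed

theorem theorem3p2:
  "\<exists>P :: nat \<Rightarrow> real.
     (\<forall>j. (\<lambda>n. gap_prob n j) \<longlonglongrightarrow> P j) \<and>
     (\<forall>j\<le>2. P j = 0) \<and>
     P 3 = 5 * a1 / (golden_mean ^ 2 * (golden_mean ^ 4 - 1)) \<and>
     (\<forall>j\<ge>4. P j = 10 * a1 * golden_mean / (golden_mean ^ 4 - 1) * golden_mean powi (- int j)) \<and>
     (\<forall>j\<ge>4. P (Suc j) = P j / golden_mean)"
proof -
  have pos: "0 < \<phi>" "0 < a1"
    using golden_mean_gt_1 by (simp_all add: a1_def)
  show ?thesis
  proof (intro exI[of _ "\<lambda>j. sign_choices j / \<phi> ^ j"] conjI allI impI)
    show "(\<lambda>n. gap_prob n j) \<longlonglongrightarrow> sign_choices j / \<phi> ^ j" for j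
      by (rule gap_prob_tendsto)
    show "sign_choices 3 / \<phi> ^ 3 = 5 * a1 / (\<phi> ^ 2 * (\<phi> ^ 4 - 1))"
      unfolding golden_mean_power_4 using pos
      by (simp add: sign_choices_def field_simps eval_nat_numeral)
    show "sign_choices j / \<phi> ^ j = 10 * a1 * \<phi> / (\<phi> ^ 4 - 1) * \<phi> powi (- int j)"
      if "4 \<le> j" for j
      unfolding golden_mean_power_4 using pos that
      by (simp add: sign_choices_def field_simps power_int_minus)
  qed (simp_all add: sign_choices_def)
qed

end
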